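(* Let $U$ be a finite nonempty set and let $\mathbf{C}$ be a covering of $U$. Then $Cov(\mathbf{C})$ is a partition of $U$ if and only if for any $x,y\in U$, either $f_{y}(x)=f_{x}(y)=0$, or both $f_{y}(x)\neq 0$ and $f_{x}(y)\neq 0$.
   Context: A covering of $U$ is a family $\mathbf{C}$ of subsets of $U$ with $\emptyset\notin\mathbf{C}$ and $\bigcup\mathbf{C}=U$; its elements are called blocks. A partition of $U$ is a covering of $U$ whose distinct blocks are disjoint. For $x\in U$, the neighborhood of $x$ is $N(x)=\bigcap\{K\in\mathbf{C}\mid x\in K\}$, and $Cov(\mathbf{C})=\{N(x)\mid x\in U\}$ (a set of subsets of $U$, without repetition). The membership repeat degree of $x$ is $\partial(x)=|\{K\in\mathbf{C}\mid x\in K\}|$. For $x,y\in U$, the common block repeat degree is $\lambda(x,y)=|\{K\in\mathbf{C}\mid \{x,y\}\subseteq K\}|$. The $y$ excluded number of $x$ is $f_{y}(x)=\partial(x)-\lambda(x,y)$. *)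

theory Defs
  imports Main "HOL-Library.Disjoint_Sets"
begin

definition covering_on :: "'a set \<Rightarrow> 'a set set \<Rightarrow> bool" where
  "covering_on U C \<longleftrightarrow> {} \<notin> C \<and> \<Union>C = U"

definition neighborhood :: "'a set set \<Rightarrow> 'a \<Rightarrow> 'a set" where
  "neighborhood C x = \<Inter>{K \<in> C. x \<in> K}"

definition Cov :: "'a set \<Rightarrow> 'a set set \<Rightarrow> 'a set set" where
  "Cov U C = {neighborhood C x | x. x \<in> U}"

definition membership_repeat_degree :: "'a set set \<Rightarrow> 'a \<Rightarrow> nat" where
  "membership_repeat_degree C x = card {K \<in> C. x \<in> K}"

definition common_block_repeat_degree :: "'a set set \<Rightarrow> 'a \<Rightarrow> 'a \<Rightarrow> nat" where
  "common_block_repeat_degree C x y = card {K \<in> C. {x, y} \<subseteq> K}"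

(* excluded_number C y x is the y excluded number of x, f_y(x);
   it is integer-valued so that the subtraction is not truncated. *)
definition excluded_number :: "'a set set \<Rightarrow> 'a \<Rightarrow> 'a \<Rightarrow> int" where
  "excluded_number C y x =
     int (membership_repeat_degree C x) - int (common_block_repeat_degree C x y)"

end

(* f_y(x) = 0 says exactly that y lies in N(x), and y in N(x) always forces N(y) to be contained
   in N(x).  So the condition on the excluded numbers is the symmetry of the relation "y in N(x)",
   which holds iff any two neighborhoods that meet are equal. *)
theory Submission
  imports Defs
begin

lemma neighborhood_self: "x \<in> neighborhood C x"
  by (auto simp: neighborhood_def)

text \<open>Every block around \<open>x\<close> then also contains \<open>y\<close>, so the
  intersection for \<open>y\<close> runs over at least the same blocks.\<close>

lemma neighborhood_mono: "y \<in> neighborhood C x \<Longrightarrow> neighborhood C y \<subseteq> neighborhood C x"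
  by (auto simp: neighborhood_def)

text \<open>Since \<open>x\<close> lies in some block, the intersection is over a nonempty family;
  an empty one would yield \<open>UNIV\<close>.\<close>

lemma neighborhood_subset:
  assumes "covering_on U C" and "x \<in> U"
  shows "neighborhood C x \<subseteq> U"
  using assms by (auto simp: neighborhood_def covering_on_def)

text \<open>The blocks containing both points form a subfamily of the finite family of blocks
  containing \<open>x\<close>, so equal cardinalities force equal families: every block around
  \<open>x\<close> contains \<open>y\<close>.\<close>

lemma excluded_number_eq_0_iff:
  assumes "finite C"
  shows "excluded_number C y x = 0 \<longleftrightarrow> y \<in> neighborhood C x"
proof -
  let ?A = "{K \<in> C. {x, y} \<subseteq> K}" and ?B = "{K \<in> C. x \<in> K}"
  have "?A \<subseteq> ?B" "finite ?B"
    using assms by auto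
  then have "card ?B = card ?A \<longleftrightarrow> ?A = ?B"
    using card_subset_eq[of ?B ?A] by auto
  moreover have "?A = ?B \<longleftrightarrow> y \<in> neighborhood C x"
    unfolding neighborhood_def by blast
  ultimately show ?thesis
    unfolding excluded_number_def membership_repeat_degree_def common_block_repeat_degree_def
    by simp
qed

lemma partition_on_Cov_iff:
  assumes "covering_on U C"
  shows "partition_on U (Cov U C) \<longleftrightarrow>
    (\<forall>x\<in>U. \<forall>y\<in>U. y \<in> neighborhood C x \<longrightarrow> x \<in> neighborhood C y)"
    (is "?P \<longleftrightarrow> ?S")
proof
  assume ?P
  show ?S
  proof (intro ballI impI)
    fix x y
    assume xy: "x \<in> U" "y \<in> U" "y \<in> neighborhood C x"
    then have "neighborhood C x \<in> Cov U C" "neighborhood C y \<in> Cov U C"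
      by (auto simp: Cov_def)
    \<comment> \<open>The two members of the partition share the point \<open>y\<close>.\<close>
    then have "neighborhood C x = neighborhood C y"
      using \<open>?P\<close> xy(3) neighborhood_self[of y C]
      unfolding partition_on_def disjoint_def by blast
    then show "x \<in> neighborhood C y"
      using neighborhood_self[of x C] by simp
  qed
next
  assume sym: ?S
  \<comment> \<open>Symmetry lets \<open>neighborhood_mono\<close> be applied in both
    directions.\<close>
  have eq: "neighborhood C x = neighborhood C z"
    if "x \<in> U" "z \<in> neighborhood C x" for x z
  proof -
    have "z \<in> U"
      using neighborhood_subset[OF assms] that by blast
    with sym that show ?thesis
      by (simp add: neighborhood_mono subset_antisym)
  qed
  show ?P
  proof (rule partition_onI)
    show "\<Union>(Cov U C) = U"
    proof
      show "\<Union>(Cov U C) \<subseteq> U"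
        using neighborhood_subset[OF assms] by (auto simp: Cov_def)
      show "U \<subseteq> \<Union>(Cov U C)"
        using neighborhood_self[of _ C] by (auto simp: Cov_def)
    qed
  next
    fix p q
    assume "p \<in> Cov U C" "q \<in> Cov U C" and neq: "p \<noteq> q"
    then obtain x y where "x \<in> U" "y \<in> U" "p = neighborhood C x" "q = neighborhood C y"
      unfolding Cov_def by blast
    \<comment> \<open>A common point \<open>z\<close> would make both \<open>p\<close> and
      \<open>q\<close> equal to \<open>neighborhood C z\<close>.\<close>
    with eq[of x] eq[of y] neq show "disjnt p q"
      unfolding disjnt_iff by metis
  next
    show "{} \<notin> Cov U C"
      using neighborhood_self[of _ C] by (auto simp: Cov_def)
  qed
qed

theorem theorem31:
  fixes U :: "'a set" and C :: "'a set set"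
  assumes "finite U" and "U \<noteq> {}" and "covering_on U C"
  shows "partition_on U (Cov U C) \<longleftrightarrow>
    (\<forall>x\<in>U. \<forall>y\<in>U.
       (excluded_number C y x = 0 \<and> excluded_number C x y = 0) \<or>
       (excluded_number C y x \<noteq> 0 \<and> excluded_number C x y \<noteq> 0))"
proof -
  have "finite C"
    using assms(1,3) by (auto simp: covering_on_def intro: finite_UnionD)
  \<comment> \<open>For each pair the condition becomes an equivalence of two memberships; as
    \<open>x\<close> and \<open>y\<close> range over all of \<open>U\<close>, one implication gives
    the other by swapping them.\<close>
  then show ?thesis
    unfolding partition_on_Cov_iff[OF assms(3)] excluded_number_eq_0_iff[OF \<open>finite C\<close>]
    by blast
qed

end
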